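(* Let $k\geq 2$ be an integer and let $A$ be a finite set of $k$ positive integers such that $|2\hat{}_{\underline{+}}A|=4k-4$. Then: (i) if $k=2$, $A=\{a_0,a_1\}$ for some positive integers $a_0<a_1$; (ii) if $k\geq 3$, $A=d*\{1,3,\ldots,2k-1\}$ for some positive integer $d$.
   Context: For a finite set $A=\{a_0,a_1,\ldots,a_{k-1}\}$ of $k$ distinct integers and an integer $1\leq h\leq k$, the $h$-fold restricted signed sumset of $A$ is $$h\hat{}_{\underline{+}}A:=\Big\{\sum_{i=0}^{k-1}\lambda_i a_i : (\lambda_0,\ldots,\lambda_{k-1})\in\{-1,0,1\}^k,\ \sum_{i=0}^{k-1}|\lambda_i|=h\Big\}.$$ $|S|$ denotes the cardinality of a finite set $S$. For an integer $d$ and a set $S$ of integers, $d*S=\{d\cdot s : s\in S\}$ is the $d$-dilation of $S$. The set $\{1,3,\ldots,2k-1\}$ consists of the first $k$ odd positive integers. *)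

theory Defs
  imports Main
begin

(* The coefficients are indexed by the elements of A rather than by an enumeration of A;
   the values of the coefficient function outside A are irrelevant.  The definition is meant for
   finite A and 1 <= h <= card A. *)
definition restricted_signed_sumset :: "nat \<Rightarrow> int set \<Rightarrow> int set" where
  "restricted_signed_sumset h A =
     {\<Sum>a\<in>A. l a * a | l :: int \<Rightarrow> int.
        (\<forall>a\<in>A. l a \<in> {-1, 0, 1}) \<and> (\<Sum>a\<in>A. \<bar>l a\<bar>) = int h}"

definition dilation :: "int \<Rightarrow> int set \<Rightarrow> int set" where
  "dilation d S = {d * s | s. s \<in> S}"

definition first_odds :: "nat \<Rightarrow> int set" where
  "first_odds k = {2 * int i - 1 | i. 1 \<le> i \<and> i \<le> k}"

end

theory Submission
  imports Defs
begin

text \<open>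
  The signed sums of two distinct elements of a set \<open>A\<close> of \<open>k\<close> positive integers are nonzero and
  come in pairs \<open>\<plusminus>s\<close>, so it is enough to study the positive ones, of which there are at most
  \<open>2 * k - 2\<close>.  Write \<open>m\<close> and \<open>M\<close> for the least and the greatest element of \<open>A\<close>.  The numbers
  \<open>x - m\<close> with \<open>x \<noteq> m\<close>, followed by the numbers \<open>M + x\<close> with \<open>x \<noteq> M\<close>, already form an
  increasing chain of \<open>2 * k - 2\<close> positive signed sums.  Hence \<^emph>\<open>every\<close> positive signed sum lies
  on this chain (\<open>positive_pair_sums_eq_chain\<close>).

  This rigidity determines \<open>A\<close>, for \<open>k \<ge> 3\<close>, by induction on \<open>k\<close>.  For \<open>A = {a, b, c}\<close> with \<open>a < b < c\<close> the
  chain is \<open>b - a, c - a, c + a, c + b\<close>; the places available on it for \<open>a + b\<close> and for \<open>c - b\<close>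
  force \<open>c = 2 * a + b\<close> and \<open>b = 3 * a\<close>.  For larger \<open>k\<close>, deleting \<open>M\<close> from \<open>A\<close> destroys
  at least two positive signed sums, namely the two largest, so the rest of \<open>A\<close> is again
  extremal and thus has the form \<open>d * {1, 3, \<dots>, 2 * k - 3}\<close>.  Its least and greatest elements
  add up to \<open>(2 * k - 2) * d\<close>, and the only place for this number on the chain of \<open>A\<close> is
  \<open>M - d\<close>, which gives \<open>M = (2 * k - 1) * d\<close>.
\<close>

section \<open>Positive signed sums of two elements\<close>

definition positive_pair_sums :: "int set \<Rightarrow> int set" where
  "positive_pair_sums A =
     {x + y | x y. x \<in> A \<and> y \<in> A \<and> x < y} \<union> {y - x | x y. x \<in> A \<and> y \<in> A \<and> x < y}"

definition extremal_chain :: "int set \<Rightarrow> int \<Rightarrow> int \<Rightarrow> int set" where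
  "extremal_chain A m M = (\<lambda>x. x - m) ` (A - {m}) \<union> (\<lambda>x. M + x) ` (A - {M})"

lemma sum_mem_positive_pair_sums:
  "x \<in> A \<Longrightarrow> y \<in> A \<Longrightarrow> x < y \<Longrightarrow> x + y \<in> positive_pair_sums A"
  unfolding positive_pair_sums_def by blast

lemma diff_mem_positive_pair_sums:
  "x \<in> A \<Longrightarrow> y \<in> A \<Longrightarrow> x < y \<Longrightarrow> y - x \<in> positive_pair_sums A"
  unfolding positive_pair_sums_def by blast

lemma positive_pair_sums_mono: "A \<subseteq> B \<Longrightarrow> positive_pair_sums A \<subseteq> positive_pair_sums B"
  unfolding positive_pair_sums_def by blast

lemma finite_positive_pair_sums:
  assumes "finite A"
  shows "finite (positive_pair_sums A)"
proof -
  have "positive_pair_sums A \<subseteq> (\<lambda>(x, y). x + y) ` (A \<times> A) \<union> (\<lambda>(x, y). y - x) ` (A \<times> A)"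
    unfolding positive_pair_sums_def by auto
  then show ?thesis
    using assms by (auto intro: finite_subset)
qed

lemma signed_pair_mem_restricted_signed_sumset:
  assumes "finite A" "a \<in> A" "b \<in> A" "a \<noteq> b" "s \<in> {-1, 1}" "t \<in> {-1, 1}"
  shows "s * a + t * b \<in> restricted_signed_sumset 2 A"
proof -
  define l where "l = (\<lambda>x. if x = a then s else if x = b then t else 0)"
  have split: "sum f A = f a + f b" if "\<And>x. x \<notin> {a, b} \<Longrightarrow> f x = 0" for f :: "int \<Rightarrow> int"
  proof -
    have "sum f A = sum f {a, b}"
      using assms that by (intro sum.mono_neutral_right) auto
    then show ?thesis
      using assms by simp
  qed
  have "(\<Sum>x\<in>A. l x * x) = s * a + t * b"
    using assms by (subst split) (auto simp: l_def)
  moreover have "(\<Sum>x\<in>A. \<bar>l x\<bar>) = int 2"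
    using assms by (subst split) (auto simp: l_def)
  moreover have "\<forall>x\<in>A. l x \<in> {-1, 0, 1}"
    using assms by (auto simp: l_def)
  ultimately show ?thesis
    unfolding restricted_signed_sumset_def by (intro CollectI exI[of _ l]) auto
qed

text \<open>The signed sumset contains the positive signed sums and, disjointly, their negatives.\<close>

lemma card_positive_pair_sums_le:
  assumes "finite A" "\<forall>a\<in>A. a > 0" "finite (restricted_signed_sumset 2 A)"
  shows "2 * card (positive_pair_sums A) \<le> card (restricted_signed_sumset 2 A)"
proof -
  let ?P = "positive_pair_sums A"
  have pos: "\<forall>p\<in>?P. p > 0"
    using assms(2) unfolding positive_pair_sums_def by fastforce
  have mem: "p \<in> restricted_signed_sumset 2 A \<and> - p \<in> restricted_signed_sumset 2 A"
    if "p \<in> ?P" for p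
  proof -
    from that obtain x y where xy: "x \<in> A" "y \<in> A" "x < y" "p = x + y \<or> p = y - x"
      unfolding positive_pair_sums_def by blast
    have "s * x + t * y \<in> restricted_signed_sumset 2 A" if "s \<in> {-1, 1}" "t \<in> {-1, 1}" for s t
      using signed_pair_mem_restricted_signed_sumset assms(1) xy that by blast
    from this[of 1 1] this[of "-1" 1] this[of 1 "-1"] this[of "-1" "-1"] xy(4)
    show ?thesis
      by auto
  qed
  have "- p \<notin> ?P" if "p \<in> ?P" for p
    using pos that by (metis neg_0_less_iff_less order_less_asym)
  then have "?P \<inter> uminus ` ?P = {}"
    by auto
  then have "card (?P \<union> uminus ` ?P) = card ?P + card (uminus ` ?P)"
    using finite_positive_pair_sums[OF assms(1)] by (intro card_Un_disjoint) auto
  also have "card (uminus ` ?P) = card ?P"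
    by (simp add: card_image)
  finally have "2 * card ?P = card (?P \<union> uminus ` ?P)"
    by simp
  also have "\<dots> \<le> card (restricted_signed_sumset 2 A)"
    using mem assms(3) by (intro card_mono) auto
  finally show ?thesis .
qed

section \<open>Rigidity of extremal sets\<close>

text \<open>
  The chain consists of \<open>2 * card A - 2\<close> positive signed sums: its two halves are translates
  of \<open>A\<close> minus a point, and they are disjoint because \<open>x - m < M + y\<close> for all positive \<open>y\<close>.
\<close>

lemma positive_pair_sums_eq_chain:
  assumes "finite A" "\<forall>a\<in>A. a > 0"
    and "m \<in> A" "M \<in> A" "\<forall>x\<in>A. m \<le> x \<and> x \<le> M"
    and "card (positive_pair_sums A) \<le> 2 * card A - 2"
  shows "positive_pair_sums A = extremal_chain A m M"
proof -
  have "extremal_chain A m M \<subseteq> positive_pair_sums A"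
  proof
    fix z assume "z \<in> extremal_chain A m M"
    then consider x where "x \<in> A" "x \<noteq> m" "z = x - m" | x where "x \<in> A" "x \<noteq> M" "z = x + M"
      unfolding extremal_chain_def by (force simp: add.commute)
    then show "z \<in> positive_pair_sums A"
    proof cases
      case 1
      then show ?thesis
        using assms(3,5) diff_mem_positive_pair_sums[of m A x] by force
    next
      case 2
      then show ?thesis
        using assms(4,5) sum_mem_positive_pair_sums[of x A M] by force
    qed
  qed
  moreover have "card (extremal_chain A m M) = 2 * card A - 2"
  proof -
    have "(\<lambda>x. x - m) ` (A - {m}) \<inter> (\<lambda>x. M + x) ` (A - {M}) = {}"
    proof -
      have "x - m \<noteq> M + y" if "x \<in> A" "y \<in> A" for x y
      proof -
        have "x \<le> M" "0 < m" "0 < y"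
          using assms that by auto
        then show ?thesis
          by linarith
      qed
      then show ?thesis
        by blast
    qed
    then have "card (extremal_chain A m M) =
        card ((\<lambda>x. x - m) ` (A - {m})) + card ((\<lambda>x. M + x) ` (A - {M}))"
      unfolding extremal_chain_def using assms(1) by (intro card_Un_disjoint) auto
    also have "\<dots> = card (A - {m}) + card (A - {M})"
      by (simp add: card_image inj_on_def)
    finally show ?thesis
      using assms(1,3,4) by simp
  qed
  ultimately show ?thesis
    using assms(1,6) card_seteq finite_positive_pair_sums by metis
qed

text \<open>
  Extremality passes to the set without its greatest element \<open>M\<close>.  If \<open>p < q\<close> are the two
  greatest remaining elements, then the remaining signed sums are at most \<open>p + q\<close>, so that
  \<open>M + p\<close> and \<open>M + q\<close> have both been lost.
\<close>

lemma card_positive_pair_sums_remove_max: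
  assumes "finite A" "\<forall>a\<in>A. a > 0" "card A \<ge> 3" "M \<in> A" "\<forall>x\<in>A. x \<le> M"
  shows "card (positive_pair_sums (A - {M})) + 2 \<le> card (positive_pair_sums A)"
proof -
  let ?B = "A - {M}"
  have fin: "finite ?B" and cardB: "card ?B \<ge> 2"
    using assms by auto
  then have neB: "?B \<noteq> {}"
    by fastforce
  define q where "q = Max ?B"
  have q: "q \<in> ?B" "\<forall>x\<in>?B. x \<le> q"
    using fin neB unfolding q_def by (auto simp del: Diff_iff)
  have "card (?B - {q}) \<ge> 1"
    using fin q(1) cardB by (simp del: Diff_iff)
  then have neC: "?B - {q} \<noteq> {}"
    by fastforce
  define p where "p = Max (?B - {q})"
  have p: "p \<in> ?B - {q}" "\<forall>x\<in>?B - {q}. x \<le> p"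
    using fin neC unfolding p_def by (auto simp del: Diff_iff)
  have ord: "p < q" "q < M"
    using p q assms(5) by force+
  have le: "z \<le> p + q" if z: "z \<in> positive_pair_sums ?B" for z
  proof -
    from z obtain x y where xy: "x \<in> ?B" "y \<in> ?B" "x < y" "z = x + y \<or> z = y - x"
      unfolding positive_pair_sums_def by blast
    have "y \<le> q" "x \<in> ?B - {q}" "x > 0"
      using xy q assms(2) by force+
    then show ?thesis
      using p(2) xy(4) by force
  qed
  have new: "p + M \<in> positive_pair_sums A" "q + M \<in> positive_pair_sums A"
    using p(1) q(1) ord assms(4) by (auto intro!: sum_mem_positive_pair_sums)
  have notin: "p + M \<notin> positive_pair_sums ?B" "q + M \<notin> positive_pair_sums ?B"
    using le ord by force+
  have "card (positive_pair_sums ?B) + 2 =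
      card (insert (p + M) (insert (q + M) (positive_pair_sums ?B)))"
    using notin ord finite_positive_pair_sums[OF fin] by simp
  also have "\<dots> \<le> card (positive_pair_sums A)"
    using new positive_pair_sums_mono[of ?B A] finite_positive_pair_sums[OF assms(1)]
    by (intro card_mono) auto
  finally show ?thesis .
qed

section \<open>Classification\<close>

lemma first_odds_eq_image: "first_odds n = (\<lambda>i. 2 * int i - 1) ` {1..n}"
  unfolding first_odds_def by auto

lemma first_odds_Suc: "first_odds (Suc n) = insert (2 * int n + 1) (first_odds n)"
  by (simp add: first_odds_eq_image atLeastAtMostSuc_conv add.commute)

lemma one_mem_first_odds: "1 \<le> n \<Longrightarrow> 1 \<in> first_odds n"
  unfolding first_odds_eq_image by (rule image_eqI[of _ _ 1]) auto

lemma last_mem_first_odds: "1 \<le> n \<Longrightarrow> 2 * int n - 1 \<in> first_odds n"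
  unfolding first_odds_eq_image by auto

lemma first_odds_three: "first_odds 3 = {1, 3, 5}"
proof -
  have "first_odds 0 = {}"
    by (simp add: first_odds_def)
  then show ?thesis
    by (auto simp: numeral_3_eq_3 first_odds_Suc)
qed

lemma first_odds_bounds: "x \<in> first_odds n \<Longrightarrow> 1 \<le> x \<and> x \<le> 2 * int n - 1"
  unfolding first_odds_def by auto

lemma dilation_eq_image: "dilation d S = (\<lambda>s. d * s) ` S"
  unfolding dilation_def by auto

lemma extremal_triple:
  assumes "finite A" "\<forall>a\<in>A. a > 0" "card A = 3" "card (positive_pair_sums A) \<le> 2 * card A - 2"
  shows "\<exists>d>0. A = dilation d (first_odds 3)"
proof -
  obtain a b c where abc: "A = {a, b, c}" "a < b" "b < c"
  proof -
    obtain x y z where "A = {x, y, z}" "x \<noteq> y" "y \<noteq> z" "x \<noteq> z"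
      using assms(3) by (auto simp: card_3_iff)
    then show ?thesis
      using that[of x y z] that[of x z y] that[of y x z] that[of y z x] that[of z x y] that[of z y x]
      by (metis insert_commute linorder_neqE)
  qed
  have apos: "a > 0"
    using assms(2) abc(1) by simp
  have "positive_pair_sums A = extremal_chain A a c"
    using positive_pair_sums_eq_chain[of A a c] assms abc by auto
  also have "\<dots> = {b - a, c - a, c + a, c + b}"
    using abc unfolding extremal_chain_def by auto
  finally have chain: "positive_pair_sums A = {b - a, c - a, c + a, c + b}" .
  have "a + b \<in> positive_pair_sums A" "c - b \<in> positive_pair_sums A"
    using abc by (auto intro!: sum_mem_positive_pair_sums diff_mem_positive_pair_sums)
  then have "a + b \<in> {b - a, c - a, c + a, c + b}" "c - b \<in> {b - a, c - a, c + a, c + b}"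
    using chain by simp_all
  then have "c = 2 * a + b" and "c - b = b - a"
    using abc(2,3) apos by auto
  then have "b = 3 * a" "c = 5 * a"
    by auto
  then have "A = dilation a (first_odds 3)"
    using abc(1) by (simp add: first_odds_three dilation_eq_image mult.commute)
  then show ?thesis
    using apos by blast
qed

text \<open>
  The extreme elements of the progression, \<open>d\<close> and \<open>q = (2 * n - 1) * d\<close>, have the sum
  \<open>q + d\<close>.  It exceeds the differences \<open>x - d\<close> with \<open>x \<le> q\<close> and lies below all sums
  \<open>M + x\<close>, which leaves only \<open>M - d\<close> on the chain.
\<close>

lemma extremal_insert_max:
  assumes "d > 0" "n \<ge> 2" "M \<notin> dilation d (first_odds n)"
    and "\<forall>x\<in>dilation d (first_odds n). x \<le> M"
    and "A = insert M (dilation d (first_odds n))"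
    and "positive_pair_sums A = extremal_chain A d M"
  shows "M = d * (2 * int n + 1)"
proof -
  let ?D = "dilation d (first_odds n)" and ?q = "d * (2 * int n - 1)"
  have d: "d \<in> ?D" and q: "?q \<in> ?D"
    using assms(2) image_eqI[OF _ one_mem_first_odds, of d "(*) d" n]
      image_eqI[OF _ last_mem_first_odds, of ?q "(*) d" n]
    by (simp_all add: dilation_eq_image)
  have bounds: "0 < x \<and> x \<le> ?q" if "x \<in> ?D" for x
    using that first_odds_bounds[of _ n] assms(1) unfolding dilation_eq_image
    by (force intro: mult_left_mono)
  have "?q < M"
    using q assms(3,4) by (metis order_le_less)
  have "d * 1 < ?q"
    using assms(1,2) by (intro mult_strict_left_mono) auto
  then have "d + ?q \<in> extremal_chain A d M"
    using sum_mem_positive_pair_sums[of d A ?q] d q assms(5,6) by auto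
  then consider x where "x \<in> A" "d + ?q = x - d" | x where "x \<in> A" "x \<noteq> M" "d + ?q = M + x"
    unfolding extremal_chain_def by blast
  then show ?thesis
  proof cases
    case 1
    then have "x \<notin> ?D"
      using bounds[of x] assms(1) by linarith
    then have "x = M"
      using 1(1) assms(5) by blast
    then show ?thesis
      using 1(2) by (simp add: algebra_simps)
  next
    case 2
    then obtain s where "s \<in> first_odds n" "x = d * s"
      using assms(5) by (auto simp: dilation_def)
    \<comment> \<open>\<open>d\<close> is the least element of the progression, so \<open>M + x\<close> is too large.\<close>
    then have "d * 1 \<le> x"
      using first_odds_bounds assms(1) mult_left_mono[of 1 s d] by auto
    then show ?thesis
      using 2(3) \<open>?q < M\<close> by linarith
  qed
qed

lemma extremal_imp_dilated_odds:
  assumes "finite A" "\<forall>a\<in>A. a > 0" "card A = n" "n \<ge> 3"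
    and "card (positive_pair_sums A) \<le> 2 * n - 2"
  shows "\<exists>d>0. A = dilation d (first_odds n)"
  using assms(4,1-3,5)
proof (induction n arbitrary: A rule: nat_induct_at_least)
  case base
  then show ?case
    using extremal_triple[of A] by simp
next
  case (Suc n)
  then have ne: "A \<noteq> {}"
    by auto
  define M where "M = Max A"
  have M: "M \<in> A" "\<forall>x\<in>A. x \<le> M"
    using Suc.prems(1) ne unfolding M_def by auto
  let ?B = "A - {M}"
  have "card (positive_pair_sums ?B) + 2 \<le> card (positive_pair_sums A)"
    using Suc.prems Suc.hyps M by (intro card_positive_pair_sums_remove_max) auto
  moreover have "card (positive_pair_sums A) \<le> 2 * n"
    using Suc.prems(4) by simp
  ultimately have small: "card (positive_pair_sums ?B) \<le> 2 * n - 2"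
    by linarith
  have "finite ?B" "\<forall>a\<in>?B. a > 0" "card ?B = n"
    using Suc.prems M by auto
  then obtain d where d: "d > 0" "?B = dilation d (first_odds n)"
    using Suc.IH small by blast
  have A: "A = insert M (dilation d (first_odds n))"
    using d(2) M(1) by blast
  have dB: "d \<in> dilation d (first_odds n)"
    using Suc.hyps image_eqI[OF _ one_mem_first_odds, of d "(*) d" n]
    by (simp add: dilation_eq_image)
  have least: "d \<le> x" if "x \<in> A" for x
  proof -
    have "d \<le> y" if "y \<in> dilation d (first_odds n)" for y
      using that d(1) mult_left_mono[of 1 _ d] first_odds_bounds[of _ n]
      by (fastforce simp: dilation_def)
    moreover have "d \<le> M"
      using M(2) dB A by blast
    ultimately show ?thesis
      using that A by blast
  qed
  have "positive_pair_sums A = extremal_chain A d M"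
    using Suc.prems M least dB A by (intro positive_pair_sums_eq_chain) auto
  then have "M = d * (2 * int n + 1)"
    using extremal_insert_max[of d n M A] d A M Suc.hyps by auto
  then have "A = dilation d (first_odds (Suc n))"
    using A by (simp add: first_odds_Suc dilation_eq_image)
  then show ?case
    using d(1) by blast
qed

theorem theorem2p2:
  fixes k :: nat and A :: "int set"
  assumes "k \<ge> 2"
    and "finite A" and "card A = k"
    and "\<forall>a\<in>A. a > 0"
    and "card (restricted_signed_sumset 2 A) = 4 * k - 4"
  shows "(k = 2 \<longrightarrow> (\<exists>a0 a1. 0 < a0 \<and> a0 < a1 \<and> A = {a0, a1})) \<and>
         (k \<ge> 3 \<longrightarrow> (\<exists>d>0. A = dilation d (first_odds k)))"
proof (intro conjI impI)
  assume "k = 2"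
  then obtain x y where "A = {x, y}" "x \<noteq> y"
    using assms(3) by (auto simp: card_2_iff)
  then show "\<exists>a0 a1. 0 < a0 \<and> a0 < a1 \<and> A = {a0, a1}"
    using assms(4) by (metis insertCI insert_commute linorder_neqE)
next
  assume "k \<ge> 3"
  have "finite (restricted_signed_sumset 2 A)"
    using assms(1,5) by (intro card_ge_0_finite) auto
  then have "2 * card (positive_pair_sums A) \<le> 4 * k - 4"
    using card_positive_pair_sums_le[of A] assms by metis
  then have "card (positive_pair_sums A) \<le> 2 * k - 2"
    by linarith
  then show "\<exists>d>0. A = dilation d (first_odds k)"
    using extremal_imp_dilated_odds assms(2-4) \<open>k \<ge> 3\<close> by blast
qed

end
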